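(* For any abstract factorial $!_{a}$, writing $r_k=\frac{(k+1)!_{a}}{k!_{a}}$ for $k\in\mathbb{N}$, either $$\limsup_{k\to\infty}\frac{1}{r_k}=1 \qquad\text{or}\qquad \limsup_{k\to\infty}\frac{1}{r_k}\le\frac12 .$$ The upper bound $\frac12$ in the second alternative is sharp: equality $\limsup_{k\to\infty} 1/r_k=\frac12$ is attained for Bhargava's factorial of the set of primes.
   Context: $\mathbb{N}=\{0,1,2,\dots\}$ and $\mathbb{Z}^+=\{1,2,3,\dots\}$. An abstract factorial is a function $!_{a}:\mathbb{N}\to\mathbb{Z}^+$, $n\mapsto n!_{a}$, such that: (1) $0!_{a}=1$; (2) for all integers $0\le k\le n$, the generalized binomial coefficient $\binom{n}{k}_{a}:=\frac{n!_{a}}{k!_{a}\,(n-k)!_{a}}$ is a positive integer; (3) for every positive integer $n$, the ordinary factorial $n!$ divides $n!_{a}$. Bhargava's factorial of the set of primes is the abstract factorial given by $0!_{a}=1$ and, for $n\ge 1$, $n!_{a}=\prod_{p}p^{\sum_{m=0}^{\infty}\left\lfloor\frac{n-1}{p^m(p-1)}\right\rfloor}$, the product (in effect finite) being over all primes $p$. *)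

theory Defs
  imports
    Complex_Main
    "HOL-Library.Liminf_Limsup"
    "HOL-Library.Extended_Real"
    "HOL-Library.Groups_Big_Fun"
    "HOL-Computational_Algebra.Primes"
begin

definition gen_binomial :: "(nat \<Rightarrow> nat) \<Rightarrow> nat \<Rightarrow> nat \<Rightarrow> real" where
  "gen_binomial a n k = real (a n) / (real (a k) * real (a (n - k)))"

definition abstract_factorial :: "(nat \<Rightarrow> nat) \<Rightarrow> bool" where
  "abstract_factorial a \<longleftrightarrow>
     (\<forall>n. a n > 0) \<and>
     a 0 = 1 \<and>
     (\<forall>n k. k \<le> n \<longrightarrow> (\<exists>b::nat. b > 0 \<and> gen_binomial a n k = real b)) \<and>
     (\<forall>n>0. fact n dvd a n)"

definition factorial_ratio :: "(nat \<Rightarrow> nat) \<Rightarrow> nat \<Rightarrow> real" where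
  "factorial_ratio a k = real (a (k + 1)) / real (a k)"

text \<open>
  Natural-number division supplies the floors. The sum over all \<open>m\<close> and the product over all
  primes are the unrestricted ones for functions with finitely many nontrivial values; that
  both are finite in this sense (so that neither takes its default value) is shown below.
\<close>

definition bhargava_exponent :: "nat \<Rightarrow> nat \<Rightarrow> nat" where
  "bhargava_exponent n p = Sum_any (\<lambda>m. (n - 1) div (p ^ m * (p - 1)))"

definition bhargava_factorial :: "nat \<Rightarrow> nat" where
  "bhargava_factorial n =
     (if n = 0 then 1
      else Prod_any (\<lambda>p. if prime p then p ^ bhargava_exponent n p else 1))"

lemma finite_bhargava_exponent_support:
  fixes n p :: nat
  assumes "prime p"
  shows "finite {m. (n - 1) div (p ^ m * (p - 1)) \<noteq> 0}"
proof (rule finite_subset)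
  show "{m. (n - 1) div (p ^ m * (p - 1)) \<noteq> 0} \<subseteq> {..n}"
  proof
    fix m assume "m \<in> {m. (n - 1) div (p ^ m * (p - 1)) \<noteq> 0}"
    then have *: "p ^ m * (p - 1) \<le> n - 1"
      by (simp add: div_eq_0_iff not_less)
    have p: "p \<ge> 2" using assms by (rule prime_ge_2_nat)
    have "m < 2 ^ m" by (rule less_exp)
    also have "2 ^ m \<le> p ^ m" using p by (rule power_mono) simp
    also have "p ^ m \<le> p ^ m * (p - 1)" using p by simp
    finally show "m \<in> {..n}" using * by simp
  qed
qed simp

lemma finite_bhargava_factorial_support:
  "finite {p::nat. (if prime p then p ^ bhargava_exponent n p else 1) \<noteq> 1}"
proof (rule finite_subset)
  show "{p::nat. (if prime p then p ^ bhargava_exponent n p else 1) \<noteq> 1} \<subseteq> {..n}"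
  proof
    fix p assume "p \<in> {p. (if prime p then p ^ bhargava_exponent n p else 1) \<noteq> 1}"
    then have p: "prime p" and e: "bhargava_exponent n p \<noteq> 0"
      by (auto split: if_splits)
    from e obtain m where "(n - 1) div (p ^ m * (p - 1)) \<noteq> 0"
      unfolding bhargava_exponent_def by (rule Sum_any.not_neutral_obtains_not_neutral)
    then have "p ^ m * (p - 1) \<le> n - 1"
      by (simp add: div_eq_0_iff not_less)
    moreover have "n \<noteq> 0"
      using \<open>(n - 1) div (p ^ m * (p - 1)) \<noteq> 0\<close> by (cases n) auto
    moreover have "1 * (p - 1) \<le> p ^ m * (p - 1)"
      using prime_gt_0_nat[OF p] by (intro mult_right_mono) auto
    ultimately have "p - 1 \<le> n - 1" "n \<noteq> 0" by linarith+
    then show "p \<in> {..n}" by simp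
  qed
qed simp

end

theory Submission imports Defs begin

text \<open>
  Since \<open>1!\<^sub>a\<close> and the binomial coefficient of \<open>k + 1\<close> over \<open>1\<close> are integers, so is every ratio
  \<open>r\<^sub>k\<close>. Thus \<open>1 / r\<^sub>k\<close> is \<open>1\<close> or at most \<open>1 / 2\<close>, and the dichotomy depends on whether the
  value \<open>1\<close> occurs infinitely often.

  For Bhargava's factorial and \<open>k > 0\<close>, the exponent of \<open>p\<close> in \<open>r\<^sub>k\<close> is the number of \<open>m\<close> with
  \<open>p ^ m * (p - 1)\<close> dividing \<open>k\<close>. The pair \<open>(p, m) = (2, 0)\<close> always contributes, and for odd \<open>k\<close>
  no other pair does.
\<close>

section \<open>Bhargava's exponents and factorial as finite sums and products\<close>

lemma bhargava_exponent_eq_sum: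
  assumes "prime p" "n \<le> N"
  shows "bhargava_exponent n p = (\<Sum>m\<le>N. (n - 1) div (p ^ m * (p - 1)))"
  unfolding bhargava_exponent_def
proof (rule Sum_any.expand_superset)
  \<comment> \<open>A nonzero term forces m < p^m \<le> n - 1, so the sum may stop at any
    \<open>N\<close> with \<open>n \<le> N\<close>. A common \<open>N\<close> lets exponents at
    different arguments be compared term by term.\<close>
  show "{m. (n - 1) div (p ^ m * (p - 1)) \<noteq> 0} \<subseteq> {..N}"
  proof
    fix m assume "m \<in> {m. (n - 1) div (p ^ m * (p - 1)) \<noteq> 0}"
    then have "p ^ m * (p - 1) \<le> n - 1"
      by (simp add: div_eq_0_iff not_less)
    moreover have "m < p ^ m"
      using prime_ge_2_nat[OF assms(1)] by (intro power_gt_expt) simp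
    moreover have "p ^ m * 1 \<le> p ^ m * (p - 1)"
      using prime_ge_2_nat[OF assms(1)] by (intro mult_left_mono) auto
    ultimately have "m \<le> N" using assms(2) by linarith
    then show "m \<in> {..N}" by simp
  qed
qed simp

text \<open>Truncated subtraction gives \<open>0 - 1 = 0\<close>, so the product formula also yields
  the separately defined value at 0.\<close>

lemma bhargava_exponent_0: "bhargava_exponent 0 p = 0"
  by (simp add: bhargava_exponent_def)

lemma bhargava_factorial_eq_prod:
  assumes "n \<le> N"
  shows "bhargava_factorial n = (\<Prod>p | prime p \<and> p \<le> N. p ^ bhargava_exponent n p)"
proof (cases "n = 0")
  case True
  then show ?thesis by (simp add: bhargava_factorial_def bhargava_exponent_0)
next
  case False
  have "bhargava_factorial n =
      Prod_any (\<lambda>p. if prime p then p ^ bhargava_exponent n p else 1)"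
    using False by (simp add: bhargava_factorial_def)
  also have "\<dots> = (\<Prod>p\<le>N. if prime p then p ^ bhargava_exponent n p else 1)"
  proof (rule Prod_any.expand_superset)
    show "{p. (if prime p then p ^ bhargava_exponent n p else 1) \<noteq> 1} \<subseteq> {..N}"
    proof
      fix p assume "p \<in> {p. (if prime p then p ^ bhargava_exponent n p else 1) \<noteq> 1}"
      then have p: "prime p" and e: "bhargava_exponent n p \<noteq> 0"
        by (auto split: if_splits)
      from e obtain m where "(n - 1) div (p ^ m * (p - 1)) \<noteq> 0"
        unfolding bhargava_exponent_def by (rule Sum_any.not_neutral_obtains_not_neutral)
      then have "p ^ m * (p - 1) \<le> n - 1"
        by (simp add: div_eq_0_iff not_less)
      moreover have "1 * (p - 1) \<le> p ^ m * (p - 1)"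
        using prime_gt_0_nat[OF p] by (intro mult_right_mono) auto
      ultimately have "p \<le> N" using False assms by linarith
      then show "p \<in> {..N}" by simp
    qed
  qed simp
  also have "\<dots> = (\<Prod>p | prime p \<and> p \<le> N. p ^ bhargava_exponent n p)"
    by (intro prod.mono_neutral_cong_right) auto
  finally show ?thesis .
qed

lemma bhargava_factorial_pos: "bhargava_factorial n > 0"
  by (simp add: bhargava_factorial_eq_prod[OF order.refl] prod_pos prime_gt_0_nat)

text \<open>This turns divisibility between factorials into inequalities between exponents, one
  prime at a time.\<close>

lemma multiplicity_bhargava_factorial:
  assumes "prime p"
  shows "multiplicity p (bhargava_factorial n) = bhargava_exponent n p"
proof -
  \<comment> \<open>The bound \<open>max n p\<close> puts \<open>p\<close> itself into the product
    even if \<open>p > n\<close>, where its exponent is 0.\<close>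
  have "multiplicity p (\<Prod>q | prime q \<and> q \<le> max n p. q ^ bhargava_exponent n q) =
      bhargava_exponent n p"
    by (subst multiplicity_prod_prime_powers) (use assms in auto)
  then show ?thesis by (simp add: bhargava_factorial_eq_prod[of n "max n p"])
qed

section \<open>Bhargava's factorial is an abstract factorial\<close>

lemma div_add_div_le: "(a::nat) div d + b div d \<le> (a + b) div d"
  by (metis div_add1_eq le_add1)

text \<open>Floors are superadditive, and (i - 1) + (j - 1) \<le> i + j - 1 holds under truncated
  subtraction even when \<open>i\<close> or \<open>j\<close> is 0. This is the integrality of the
  binomial coefficients at each prime.\<close>

lemma bhargava_exponent_superadditive:
  assumes "prime p"
  shows "bhargava_exponent i p + bhargava_exponent j p \<le> bhargava_exponent (i + j) p"
proof -
  have "(i - 1) div d + (j - 1) div d \<le> (i + j - 1) div d" for d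
    using div_add_div_le[of "i - 1" d "j - 1"]
      div_le_mono[of "i - 1 + (j - 1)" "i + j - 1" d] by linarith
  then have "(\<Sum>m\<le>i + j. (i - 1) div (p ^ m * (p - 1)) + (j - 1) div (p ^ m * (p - 1))) \<le>
      (\<Sum>m\<le>i + j. (i + j - 1) div (p ^ m * (p - 1)))"
    by (intro sum_mono)
  then show ?thesis
    using assms by (simp add: bhargava_exponent_eq_sum[where N = "i + j"] sum.distrib)
qed

lemma bhargava_factorial_mult_dvd:
  "bhargava_factorial i * bhargava_factorial j dvd bhargava_factorial (i + j)"
  using bhargava_factorial_pos[of i] bhargava_factorial_pos[of j]
  by (intro multiplicity_le_imp_dvd)
    (auto simp: prime_elem_multiplicity_mult_distrib multiplicity_bhargava_factorial
      bhargava_exponent_superadditive)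

text \<open>The upper bound from Legendre's formula. In the induction on \<open>n\<close> with
  \<open>N\<close> fixed, the new factor n + 1 contributes one for each \<open>m\<close> with
  p^(m+1) dividing it, and these are the \<open>m\<close> whose floor grows by one.\<close>

lemma multiplicity_fact_le:
  assumes "prime p" "n \<le> N"
  shows "multiplicity p (fact n :: nat) \<le> (\<Sum>m\<le>N. n div p ^ Suc m)"
  using assms(2)
proof (induction n)
  case 0
  then show ?case by simp
next
  case (Suc n)
  let ?D = "{m. m \<le> N \<and> p ^ Suc m dvd Suc n}"
  have "multiplicity p (Suc n) \<le> card ?D"
  proof -
    have "m \<in> ?D" if "m < multiplicity p (Suc n)" for m
    proof -
      have "p ^ Suc m dvd Suc n"
        using that by (intro multiplicity_dvd') simp
      moreover from this have "p ^ Suc m \<le> Suc n" by (rule dvd_imp_le) simp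
      moreover have "Suc m < p ^ Suc m"
        using prime_ge_2_nat[OF assms(1)] by (intro power_gt_expt) simp
      ultimately show ?thesis using Suc.prems by simp
    qed
    then have "card {..<multiplicity p (Suc n)} \<le> card ?D"
      by (intro card_mono) auto
    then show ?thesis by simp
  qed
  also have "card ?D = (\<Sum>m\<le>N. of_bool (p ^ Suc m dvd Suc n))"
    by (subst sum_of_bool_eq) (auto intro!: arg_cong[of _ _ card])
  finally have "multiplicity p (Suc n) + multiplicity p (fact n :: nat) \<le>
      (\<Sum>m\<le>N. of_bool (p ^ Suc m dvd Suc n) + n div p ^ Suc m)"
    using Suc by (simp only: sum.distrib) simp
  also have "\<dots> = (\<Sum>m\<le>N. Suc n div p ^ Suc m)"
    by (intro sum.cong refl) (simp only: div_Suc dvd_eq_mod_eq_0, simp)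
  finally show ?case
    using assms(1) by (simp only: fact_Suc of_nat_id)
      (subst prime_elem_multiplicity_mult_distrib, auto)
qed

text \<open>At each prime, every floor in Legendre's formula is dominated by the Bhargava floor of
  the same index.\<close>

lemma fact_dvd_bhargava_factorial: "fact n dvd bhargava_factorial n"
proof (rule multiplicity_le_imp_dvd)
  fix p :: nat assume p: "prime p"
  have "multiplicity p (fact n :: nat) \<le> (\<Sum>m\<le>n. n div p ^ Suc m)"
    using p by (intro multiplicity_fact_le) auto
  also have "\<dots> \<le> (\<Sum>m\<le>n. (n - 1) div (p ^ m * (p - 1)))"
  proof (intro sum_mono)
    fix m
    let ?q = "n div p ^ Suc m" and ?d = "p ^ m * (p - 1)"
    show "?q \<le> (n - 1) div ?d"
    proof (cases "?q = 0")
      case False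
      \<comment> \<open>As \<open>?d\<close> is p^(m+1) - p^m, replacing p^(m+1) by
        \<open>?d\<close> in \<open>?q * p ^ Suc m \<le> n\<close> saves \<open>?q * p ^ m\<close>.
        This is at least 1 and pays for the shift from n to n - 1.\<close>
      have "p ^ m > 0" using prime_gt_0_nat[OF p] by simp
      then have "?q * p ^ m \<ge> 1" using False by (metis One_nat_def Suc_leI mult_pos_pos neq0_conv)
      moreover have "?q * ?d + ?q * p ^ m = ?q * p ^ Suc m"
        using prime_gt_0_nat[OF p] by (cases p) (auto simp: algebra_simps)
      moreover have "?q * p ^ Suc m \<le> n" by (rule div_times_less_eq_dividend)
      ultimately have "?q * ?d \<le> n - 1" by linarith
      moreover have "?d > 0" using prime_ge_2_nat[OF p] by simp
      ultimately show ?thesis by (simp add: less_eq_div_iff_mult_less_eq)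
    qed simp
  qed
  also have "\<dots> = multiplicity p (bhargava_factorial n)"
    by (simp only: bhargava_exponent_eq_sum[OF p order.refl] multiplicity_bhargava_factorial[OF p])
  finally show "multiplicity p (fact n :: nat) \<le> multiplicity p (bhargava_factorial n)" .
qed simp

lemma abstract_factorial_bhargava: "abstract_factorial bhargava_factorial"
  unfolding abstract_factorial_def
proof (intro conjI allI impI)
  show "bhargava_factorial n > 0" for n by (rule bhargava_factorial_pos)
  show "bhargava_factorial 0 = 1" by (simp add: bhargava_factorial_def)
  show "fact n dvd bhargava_factorial n" for n by (rule fact_dvd_bhargava_factorial)
  fix n k :: nat assume "k \<le> n"
  then obtain b where b: "bhargava_factorial n =
      bhargava_factorial k * bhargava_factorial (n - k) * b"
    using bhargava_factorial_mult_dvd[of k "n - k"] by (auto elim: dvdE)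
  then have "b > 0" using bhargava_factorial_pos[of n] by (cases b) auto
  moreover have "gen_binomial bhargava_factorial n k = real b"
    using bhargava_factorial_pos[of k] bhargava_factorial_pos[of "n - k"]
    by (simp add: gen_binomial_def b)
  ultimately show "\<exists>b>0. gen_binomial bhargava_factorial n k = real b" by blast
qed

section \<open>Consecutive ratios of Bhargava's factorial\<close>

lemma bhargava_exponent_Suc_Suc:
  assumes "prime p"
  shows "bhargava_exponent (Suc (Suc j)) p =
    bhargava_exponent (Suc j) p + card {m. m \<le> Suc (Suc j) \<and> p ^ m * (p - 1) dvd Suc j}"
proof -
  \<comment> \<open>The two dividends are j + 1 and j, and the floor for divisor d rises by one
    exactly when d divides j + 1. The double successor keeps both subtractions of one
    genuine.\<close>
  have "bhargava_exponent (Suc (Suc j)) p =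
      (\<Sum>m\<le>Suc (Suc j). j div (p ^ m * (p - 1)) + of_bool (p ^ m * (p - 1) dvd Suc j))"
    unfolding bhargava_exponent_eq_sum[OF assms order.refl]
    by (intro sum.cong refl) (simp only: div_Suc dvd_eq_mod_eq_0 diff_Suc_1, simp)
  also have "\<dots> = bhargava_exponent (Suc j) p +
      (\<Sum>m\<le>Suc (Suc j). of_bool (p ^ m * (p - 1) dvd Suc j))"
    using bhargava_exponent_eq_sum[OF assms, of "Suc j" "Suc (Suc j)"]
    by (simp only: sum.distrib) simp
  also have "(\<Sum>m\<le>Suc (Suc j). of_bool (p ^ m * (p - 1) dvd Suc j)) =
      card {m. m \<le> Suc (Suc j) \<and> p ^ m * (p - 1) dvd Suc j}"
    by (subst sum_of_bool_eq) (auto intro!: arg_cong[of _ _ card])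
  finally show ?thesis .
qed

lemma multiplicity_two_mult:
  assumes "prime p" "x > (0::nat)"
  shows "multiplicity p (2 * x) = of_bool (p = 2) + multiplicity p x"
proof -
  have "multiplicity p (2::nat) = of_bool (p = 2)"
    using assms(1) by (auto simp: prime_multiplicity_other)
  then show ?thesis
    using assms by (subst prime_elem_multiplicity_mult_distrib) auto
qed

text \<open>Gives r_k \<ge> 2 away from k = 0, where the ratio is 1.\<close>

lemma two_mult_bhargava_factorial_dvd:
  assumes "k > 0"
  shows "2 * bhargava_factorial k dvd bhargava_factorial (Suc k)"
proof (rule multiplicity_le_imp_dvd)
  fix p :: nat assume p: "prime p"
  obtain j where k: "k = Suc j" using assms by (cases k) auto
  \<comment> \<open>For p = 2 and m = 0 the divisor is 1, so the index 0 is always counted; this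
    supplies the factor 2.\<close>
  have "card {0::nat} \<le> card {m. m \<le> Suc (Suc j) \<and> 2 ^ m * (2 - 1) dvd Suc j}"
    by (intro card_mono) auto
  then show "multiplicity p (2 * bhargava_factorial k) \<le> multiplicity p (bhargava_factorial (Suc k))"
    using p by (simp add: multiplicity_two_mult bhargava_factorial_pos
        multiplicity_bhargava_factorial k bhargava_exponent_Suc_Suc)
qed (use bhargava_factorial_pos[of k] in simp)

text \<open>Odd indices provide infinitely many k with r_k = 2, so that the bound 1/2 is
  attained.\<close>

lemma bhargava_factorial_Suc_odd:
  assumes "odd k"
  shows "bhargava_factorial (Suc k) = 2 * bhargava_factorial k"
proof (rule dvd_antisym)
  have "k > 0" using assms by (rule odd_pos)
  then show "2 * bhargava_factorial k dvd bhargava_factorial (Suc k)"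
    by (rule two_mult_bhargava_factorial_dvd)
  obtain j where k: "k = Suc j" using \<open>k > 0\<close> by (cases k) auto
  show "bhargava_factorial (Suc k) dvd 2 * bhargava_factorial k"
  proof (rule multiplicity_le_imp_dvd)
    fix p :: nat assume p: "prime p"
    \<comment> \<open>All divisors of the odd number \<open>k\<close> are odd. An odd p - 1 makes
      the prime \<open>p\<close> equal to 2, and an odd power of 2 has exponent 0.\<close>
    have *: "m = 0 \<and> p = 2" if "p ^ m * (p - 1) dvd k" for m
    proof -
      have "odd (p ^ m * (p - 1))" using that assms by (metis dvd_trans)
      then have "odd (p - 1)" "odd p \<or> m = 0" by auto
      then show ?thesis using p prime_gt_0_nat[OF p] prime_odd_nat[OF p]
        by (cases "p = 2") (auto simp: prime_ge_2_nat le_less)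
    qed
    have "{m. m \<le> Suc (Suc j) \<and> p ^ m * (p - 1) dvd k} \<subseteq> (if p = 2 then {0} else {})"
    proof
      fix m assume "m \<in> {m. m \<le> Suc (Suc j) \<and> p ^ m * (p - 1) dvd k}"
      then have "m = 0 \<and> p = 2" by (intro *) simp
      then show "m \<in> (if p = 2 then {0} else {})" by simp
    qed
    then have "card {m. m \<le> Suc (Suc j) \<and> p ^ m * (p - 1) dvd k} \<le>
        card (if p = 2 then {0::nat} else {})"
      by (rule card_mono[rotated]) simp
    then show "multiplicity p (bhargava_factorial (Suc k)) \<le>
        multiplicity p (2 * bhargava_factorial k)"
      using p by (simp add: multiplicity_two_mult bhargava_factorial_pos
          multiplicity_bhargava_factorial k bhargava_exponent_Suc_Suc split: if_splits)
  qed (use bhargava_factorial_pos[of "Suc k"] in simp)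
qed

section \<open>Limits superior of the reciprocal ratios\<close>

lemma limsup_eqI_frequently:
  fixes f :: "nat \<Rightarrow> ereal"
  assumes "\<forall>\<^sub>F n in sequentially. f n \<le> c" "\<exists>\<^sub>F n in sequentially. f n = c"
  shows "limsup f = c"
proof (rule antisym)
  show "limsup f \<le> c" using assms(1) by (rule Limsup_bounded)
  show "c \<le> limsup f"
  proof (rule ccontr)
    assume "\<not> c \<le> limsup f"
    \<comment> \<open>A limit superior below \<open>c\<close> would keep \<open>f\<close> strictly
      below \<open>c\<close> from some point on, against its taking the value \<open>c\<close>
      infinitely often.\<close>
    then have "\<forall>\<^sub>F n in sequentially. f n < c" by (intro Limsup_lessD) simp
    then have "\<forall>\<^sub>F n in sequentially. f n \<noteq> c" by (rule eventually_mono) simp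
    then show False using assms(2) by (simp add: frequently_def)
  qed
qed

lemma factorial_ratio_pos_nat:
  assumes "abstract_factorial a"
  obtains b :: nat where "b > 0" "factorial_ratio a k = real b"
proof -
  have pos: "a n > 0" for n using assms by (simp add: abstract_factorial_def)
  obtain b :: nat where b: "b > 0" "gen_binomial a (k + 1) 1 = real b"
    using assms unfolding abstract_factorial_def by (metis le_add2)
  \<comment> \<open>The binomial coefficient divides (k + 1)! by both k! and 1!, and 1! may exceed
    1; hence the factor \<open>a 1\<close>.\<close>
  have "factorial_ratio a k = real (a 1 * b)"
    using b(2) pos[of 1] pos[of k] by (simp add: factorial_ratio_def gen_binomial_def field_simps)
  with b(1) pos[of 1] show ?thesis by (intro that[of "a 1 * b"]) auto
qed

lemma limsup_inverse_factorial_ratio_dichotomy: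
  assumes "abstract_factorial a"
  shows "limsup (\<lambda>k. ereal (1 / factorial_ratio a k)) = 1 \<or>
    limsup (\<lambda>k. ereal (1 / factorial_ratio a k)) \<le> ereal (1 / 2)"
proof (cases "\<exists>\<^sub>F k in sequentially. ereal (1 / factorial_ratio a k) = 1")
  case True
  have "ereal (1 / factorial_ratio a k) \<le> 1" for k
    by (rule factorial_ratio_pos_nat[OF assms, of k]) (simp add: one_ereal_def)
  then have "limsup (\<lambda>k. ereal (1 / factorial_ratio a k)) = 1"
    using True by (intro limsup_eqI_frequently) simp_all
  then show ?thesis ..
next
  case False
  have "ereal (1 / factorial_ratio a k) \<le> ereal (1 / 2)"
    if "ereal (1 / factorial_ratio a k) \<noteq> 1" for k
  proof -
    obtain b :: nat where b: "b > 0" "factorial_ratio a k = real b"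
      by (rule factorial_ratio_pos_nat[OF assms])
    then have "b \<noteq> 1" using that by (auto simp: one_ereal_def)
    then have "real b \<ge> 2" using b(1) by linarith
    then show ?thesis by (simp add: b field_simps)
  qed
  with False have "\<forall>\<^sub>F k in sequentially. ereal (1 / factorial_ratio a k) \<le> ereal (1 / 2)"
    by (auto simp: frequently_def elim!: eventually_mono)
  then have "limsup (\<lambda>k. ereal (1 / factorial_ratio a k)) \<le> ereal (1 / 2)"
    by (rule Limsup_bounded)
  then show ?thesis ..
qed

lemma limsup_inverse_bhargava_ratio:
  "limsup (\<lambda>k. ereal (1 / factorial_ratio bhargava_factorial k)) = ereal (1 / 2)"
proof (rule limsup_eqI_frequently)
  have "ereal (1 / factorial_ratio bhargava_factorial k) \<le> ereal (1 / 2)" if "k > 0" for k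
  proof -
    have "2 * bhargava_factorial k \<le> bhargava_factorial (Suc k)"
      using that by (intro dvd_imp_le two_mult_bhargava_factorial_dvd bhargava_factorial_pos)
    then have "2 * real (bhargava_factorial k) \<le> real (bhargava_factorial (Suc k))"
      by linarith
    then show ?thesis
      using bhargava_factorial_pos[of "Suc k"] by (simp add: factorial_ratio_def field_simps)
  qed
  then show "\<forall>\<^sub>F k in sequentially.
      ereal (1 / factorial_ratio bhargava_factorial k) \<le> ereal (1 / 2)"
    by (intro eventually_mono[OF eventually_gt_at_top[of 0]])
  \<comment> \<open>The odd index 2n + 1 lies beyond any given n, which gives the value 1/2
    infinitely often.\<close>
  have "ereal (1 / factorial_ratio bhargava_factorial (2 * n + 1)) = ereal (1 / 2)" for n
    using bhargava_factorial_Suc_odd[of "2 * n + 1"] bhargava_factorial_pos[of "2 * n + 1"]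
    by (simp add: factorial_ratio_def)
  moreover have "2 * n + 1 \<ge> n" for n :: nat by simp
  ultimately show "\<exists>\<^sub>F k in sequentially.
      ereal (1 / factorial_ratio bhargava_factorial k) = ereal (1 / 2)"
    unfolding frequently_sequentially by blast
qed

theorem lemma10:
  shows "(\<forall>a. abstract_factorial a \<longrightarrow>
            limsup (\<lambda>k. ereal (1 / factorial_ratio a k)) = 1 \<or>
            limsup (\<lambda>k. ereal (1 / factorial_ratio a k)) \<le> ereal (1 / 2)) \<and>
         abstract_factorial bhargava_factorial \<and>
         limsup (\<lambda>k. ereal (1 / factorial_ratio bhargava_factorial k)) = ereal (1 / 2)"
  using limsup_inverse_factorial_ratio_dichotomy abstract_factorial_bhargava
    limsup_inverse_bhargava_ratio by blast

end
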